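(* Let $(\Omega,\mathcal{H},\hat{E})$ be a sublinear expectation space as described in the context, where $\hat{E}$ has the monotone continuity property, and let $\{X,X_n,n\ge1\}$ be a sequence of random variables in $\mathcal{H}$. If $X_n$ converges to $X$ in capacity (for every $\varepsilon>0$, $\lim_{n\to\infty}V(\{|X_n-X|\ge\varepsilon\})=0$), then $X_n$ converges to $X$ in distribution (for every bounded continuous $\varphi:\mathbb{R}\to\mathbb{R}$, $\lim_{n\to\infty}\hat{E}[\varphi(X_n)]=\hat{E}[\varphi(X)]$).
   Context: Setting. $\Omega$ is a complete separable metric space with Borel $\sigma$-algebra $\mathcal{B}(\Omega)$. $\mathcal{H}$ is a linear space of real (measurable) functions on $\Omega$ such that: every constant belongs to $\mathcal{H}$; $X\in\mathcal{H}$ implies $|X|\in\mathcal{H}$; $X_1,\dots,X_n\in\mathcal{H}$ implies $\varphi(X_1,\dots,X_n)\in\mathcal{H}$ for every $\varphi:\mathbb{R}^n\to\mathbb{R}$ satisfying $|\varphi(x)-\varphi(y)|\le C(1+|x|^m+|y|^m)|x-y|$ for all $x,y$, for some $C>0$, $m\in\mathbb{N}$ depending on $\varphi$; $I_A\in\mathcal{H}$ for all $A\in\mathcal{B}(\Omega)$; and $f(X)\in\mathcal{H}$ for every $X\in\mathcal{H}$ and every bounded continuous $f:\mathbb{R}\to\mathbb{R}$. A sublinear expectation is a functional $\hat{E}:\mathcal{H}\to\mathbb{R}$ that is monotone ($X\ge Y\Rightarrow \hat{E}[X]\ge\hat{E}[Y]$), constant preserving ($\hat{E}[c]=c$), sub-additive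 ($\hat{E}[X+Y]\le\hat{E}[X]+\hat{E}[Y]$) and positively homogeneous ($\hat{E}[\lambda X]=\lambda\hat{E}[X]$, $\lambda\ge0$). It is assumed that there is a family $\mathcal{P}$ of probability measures on $(\Omega,\mathcal{B}(\Omega))$ with $\hat{E}[X]=\sup_{P\in\mathcal{P}}E_P[X]$ for all $X\in\mathcal{H}$. The capacity is $V(A):=\hat{E}[I_A]=\sup_{P\in\mathcal{P}}P(A)$ for $A\in\mathcal{B}(\Omega)$. Monotone continuity property: for any sequence $X_n$ in $\mathcal{H}$ with $X_n\downarrow0$ pointwise on $\Omega$, $\hat{E}[X_n]\downarrow0$. *)

theory Defs
  imports "HOL-Probability.Probability"
begin

text \<open>
  Points of R^n are extensional functions on \<open>{..<n}\<close>, and \<^term>\<open>L2_set x {..<n}\<close> is the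
  Euclidean norm.
\<close>

definition loc_lipschitz :: "nat \<Rightarrow> ((nat \<Rightarrow> real) \<Rightarrow> real) \<Rightarrow> bool" where
  "loc_lipschitz n \<phi> \<longleftrightarrow>
     (\<exists>C>0. \<exists>m::nat. \<forall>x \<in> {..<n} \<rightarrow>\<^sub>E UNIV. \<forall>y \<in> {..<n} \<rightarrow>\<^sub>E UNIV.
        \<bar>\<phi> x - \<phi> y\<bar> \<le> C * (1 + L2_set x {..<n} ^ m + L2_set y {..<n} ^ m)
                          * L2_set (\<lambda>i. x i - y i) {..<n})"

locale random_variable_space =
  fixes H :: "('a::polish_space \<Rightarrow> real) set"
  assumes measurable: "X \<in> H \<Longrightarrow> X \<in> borel_measurable borel"
    and add_closed: "X \<in> H \<Longrightarrow> Y \<in> H \<Longrightarrow> (\<lambda>\<omega>. X \<omega> + Y \<omega>) \<in> H"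
    and scale_closed: "X \<in> H \<Longrightarrow> (\<lambda>\<omega>. c * X \<omega>) \<in> H"
    and const_mem: "(\<lambda>_. c) \<in> H"
    and abs_closed: "X \<in> H \<Longrightarrow> (\<lambda>\<omega>. \<bar>X \<omega>\<bar>) \<in> H"
    and lipschitz_closed:
      "(\<And>i. i < n \<Longrightarrow> Xs i \<in> H) \<Longrightarrow> loc_lipschitz n \<phi>
         \<Longrightarrow> (\<lambda>\<omega>. \<phi> (\<lambda>i\<in>{..<n}. Xs i \<omega>)) \<in> H"
    and indicator_mem: "A \<in> sets borel \<Longrightarrow> indicat_real A \<in> H"
    and bounded_continuous_closed:
      "X \<in> H \<Longrightarrow> continuous_on UNIV f \<Longrightarrow> bounded (range f) \<Longrightarrow> (\<lambda>\<omega>. f (X \<omega>)) \<in> H"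

text \<open>
  The supremum is taken in the extended reals, so the equation forces the family to be nonempty
  and the expectations to be bounded above. Integrability is required because the Bochner integral
  of a non-integrable function is 0 by convention; mathematically it is automatic from the
  finiteness of \<open>E |X|\<close>.
\<close>

definition upper_expectation_of ::
  "'a::polish_space measure set \<Rightarrow> ('a \<Rightarrow> real) set \<Rightarrow> (('a \<Rightarrow> real) \<Rightarrow> real) \<Rightarrow> bool" where
  "upper_expectation_of \<P> H E \<longleftrightarrow>
     (\<forall>P\<in>\<P>. prob_space P \<and> sets P = sets borel) \<and>
     (\<forall>X\<in>H. (\<forall>P\<in>\<P>. integrable P X) \<and> ereal (E X) = (SUP P\<in>\<P>. ereal (integral\<^sup>L P X)))"

text \<open>The values of \<open>E\<close> outside \<open>H\<close> are irrelevant.\<close>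

locale sublinear_expectation_space = random_variable_space H
  for H :: "('a::polish_space \<Rightarrow> real) set" +
  fixes E :: "('a \<Rightarrow> real) \<Rightarrow> real"
  assumes monotone: "X \<in> H \<Longrightarrow> Y \<in> H \<Longrightarrow> (\<And>\<omega>. Y \<omega> \<le> X \<omega>) \<Longrightarrow> E Y \<le> E X"
    and const_preserving: "E (\<lambda>_. c) = c"
    and sub_additive: "X \<in> H \<Longrightarrow> Y \<in> H \<Longrightarrow> E (\<lambda>\<omega>. X \<omega> + Y \<omega>) \<le> E X + E Y"
    and positively_homogeneous: "X \<in> H \<Longrightarrow> 0 \<le> l \<Longrightarrow> E (\<lambda>\<omega>. l * X \<omega>) = l * E X"
    and representation: "\<exists>\<P>. upper_expectation_of \<P> H E"

definition capacity :: "(('a \<Rightarrow> real) \<Rightarrow> real) \<Rightarrow> 'a set \<Rightarrow> real" where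
  "capacity E A = E (indicat_real A)"

definition monotone_continuity :: "('a \<Rightarrow> real) set \<Rightarrow> (('a \<Rightarrow> real) \<Rightarrow> real) \<Rightarrow> bool" where
  "monotone_continuity H E \<longleftrightarrow>
     (\<forall>X :: nat \<Rightarrow> 'a \<Rightarrow> real.
        (\<forall>n. X n \<in> H) \<longrightarrow> (\<forall>\<omega>. decseq (\<lambda>n. X n \<omega>) \<and> (\<lambda>n. X n \<omega>) \<longlonglongrightarrow> 0) \<longrightarrow>
        decseq (\<lambda>n. E (X n)) \<and> (\<lambda>n. E (X n)) \<longlonglongrightarrow> 0)"

definition converges_in_capacity ::
  "(('a \<Rightarrow> real) \<Rightarrow> real) \<Rightarrow> (nat \<Rightarrow> 'a \<Rightarrow> real) \<Rightarrow> ('a \<Rightarrow> real) \<Rightarrow> bool" where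
  "converges_in_capacity E Xs X \<longleftrightarrow>
     (\<forall>\<epsilon>>0. (\<lambda>n. capacity E {\<omega>. \<bar>Xs n \<omega> - X \<omega>\<bar> \<ge> \<epsilon>}) \<longlonglongrightarrow> 0)"

definition converges_in_distribution ::
  "(('a \<Rightarrow> real) \<Rightarrow> real) \<Rightarrow> (nat \<Rightarrow> 'a \<Rightarrow> real) \<Rightarrow> ('a \<Rightarrow> real) \<Rightarrow> bool" where
  "converges_in_distribution E Xs X \<longleftrightarrow>
     (\<forall>\<phi> :: real \<Rightarrow> real. continuous_on UNIV \<phi> \<longrightarrow> bounded (range \<phi>) \<longrightarrow>
        (\<lambda>n. E (\<lambda>\<omega>. \<phi> (Xs n \<omega>))) \<longlonglongrightarrow> E (\<lambda>\<omega>. \<phi> (X \<omega>)))"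

end

theory Submission
  imports Defs
begin

text \<open>
  Monotone continuity, applied to the indicators of \<open>{\<bar>X\<bar> \<ge> N}\<close>, makes \<open>X\<close> tight: \<open>X\<close> is bounded
  outside a set of small capacity. A bounded continuous \<open>\<phi>\<close> is uniformly continuous on compact
  intervals, so \<open>\<phi>(X\<^sub>n)\<close> and \<open>\<phi>(X)\<close> differ by at most \<open>e\<close> except on the union of
  \<open>{\<bar>X\<bar> \<ge> N}\<close> and \<open>{\<bar>X\<^sub>n - X\<bar> \<ge> \<delta>}\<close>, where they differ by at most \<open>2 sup \<bar>\<phi>\<bar>\<close>. Sub-additivity
  turns this pointwise bound into one for the expectations.
\<close>

context sublinear_expectation_space
begin

text \<open>Monotonicity passes the pointwise bound to \<open>E\<close>, and sub-additivity then
  splits off the terms one at a time; \<open>0 \<le> c\<close> lets positive homogeneity turn the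
  indicator terms into capacities.\<close>

lemma expectation_le_capacity:
  assumes "U \<in> H" "W \<in> H" "A \<in> sets borel" "B \<in> sets borel" "0 \<le> c"
    and le: "\<And>\<omega>. U \<omega> \<le> W \<omega> + (e + (c * indicat_real A \<omega> + c * indicat_real B \<omega>))"
  shows "E U \<le> E W + e + c * capacity E A + c * capacity E B"
proof -
  let ?a = "\<lambda>\<omega>. c * indicat_real A \<omega>" and ?b = "\<lambda>\<omega>. c * indicat_real B \<omega>"
  have a: "?a \<in> H" "E ?a = c * capacity E A" and b: "?b \<in> H" "E ?b = c * capacity E B"
    using assms by (auto simp: capacity_def positively_homogeneous indicator_mem intro!: scale_closed)
  have ab: "(\<lambda>\<omega>. ?a \<omega> + ?b \<omega>) \<in> H"
    using a b by (intro add_closed)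
  have eab: "(\<lambda>\<omega>. e + (?a \<omega> + ?b \<omega>)) \<in> H"
    by (rule add_closed[OF const_mem ab])
  have "E U \<le> E (\<lambda>\<omega>. W \<omega> + (e + (?a \<omega> + ?b \<omega>)))"
    by (rule monotone[OF add_closed[OF \<open>W \<in> H\<close> eab] \<open>U \<in> H\<close> le])
  then show ?thesis
    using sub_additive[OF \<open>W \<in> H\<close> eab] sub_additive[OF const_mem ab, of e]
      sub_additive[OF a(1) b(1)] a(2) b(2) const_preserving[of e]
    by linarith
qed

text \<open>\<open>X\<close> is finite at every point, so the indicators of its tails decrease
  pointwise to 0 and monotone continuity applies to them.\<close>

lemma capacity_tail_tendsto_0:
  assumes "monotone_continuity H E" "X \<in> H"
  shows "(\<lambda>N. capacity E {\<omega>. real N \<le> \<bar>X \<omega>\<bar>}) \<longlonglongrightarrow> 0"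
proof -
  let ?I = "\<lambda>N::nat. indicat_real {\<omega>. real N \<le> \<bar>X \<omega>\<bar>}"
  have [measurable]: "X \<in> borel_measurable borel"
    using assms measurable by simp
  have mem: "?I N \<in> H" for N
    by (intro indicator_mem) measurable
  have dec: "decseq (\<lambda>N. ?I N \<omega>)" for \<omega>
    by (auto simp: decseq_def indicator_def)
  have lim: "(\<lambda>N. ?I N \<omega>) \<longlonglongrightarrow> 0" for \<omega>
  proof (rule tendsto_eventually)
    obtain N0 :: nat where "\<bar>X \<omega>\<bar> < real N0"
      using reals_Archimedean2 by blast
    then show "\<forall>\<^sub>F N in sequentially. ?I N \<omega> = 0"
      by (intro eventually_sequentiallyI[of N0]) (auto simp: indicator_def)
  qed
  show ?thesis
    using assms(1)[unfolded monotone_continuity_def, rule_format, of ?I] mem dec lim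
    by (simp add: capacity_def)
qed

end

theorem proposition3p7:
  fixes H :: "('a::polish_space \<Rightarrow> real) set"
    and E :: "('a \<Rightarrow> real) \<Rightarrow> real"
    and X :: "'a \<Rightarrow> real"
    and Xs :: "nat \<Rightarrow> 'a \<Rightarrow> real"
  assumes "sublinear_expectation_space H E"
    and "monotone_continuity H E"
    and "X \<in> H"
    and "\<And>n. n \<ge> 1 \<Longrightarrow> Xs n \<in> H"
    and "converges_in_capacity E Xs X"
  shows "converges_in_distribution E Xs X"
  unfolding converges_in_distribution_def
proof (intro allI impI LIMSEQ_I)
  interpret sublinear_expectation_space H E by fact
  fix \<phi> :: "real \<Rightarrow> real" and r :: real
  assume cont: "continuous_on UNIV \<phi>" and bdd: "bounded (range \<phi>)" and "0 < r"
  \<comment> \<open>One third each for the oscillation of \<open>\<phi>\<close>, the tail of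
    \<open>X\<close> and the event that \<open>Xs n\<close> is far from \<open>X\<close>. The last
    two are strictly below \<open>e\<close>, so the total is strictly below
    \<open>r\<close>.\<close>
  define e where "e = r / 3"
  have "0 < e" using \<open>0 < r\<close> by (simp add: e_def)
  obtain M where M: "0 < M" "\<And>x. \<bar>\<phi> x\<bar> \<le> M"
    using bdd by (auto simp: bounded_pos)
  let ?A = "\<lambda>N::nat. {\<omega>. real N \<le> \<bar>X \<omega>\<bar>}"
  have "(\<lambda>N. 2 * M * capacity E (?A N)) \<longlonglongrightarrow> 0"
    using tendsto_mult_right_zero[OF capacity_tail_tendsto_0[OF assms(2,3)]] .
  \<comment> \<open>\<open>N\<close> is fixed first: the modulus of continuity chosen next depends
    on it, and the threshold \<open>n0\<close> depends on that modulus.\<close>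
  then obtain N :: nat where N: "2 * M * capacity E (?A N) < e"
    using \<open>0 < e\<close> by (metis (lifting) eventually_happens order_tendstoD(2) sequentially_bot)
  \<comment> \<open>The margin 1 leaves room for \<open>Xs n\<close>, which is only known to be near
    \<open>X\<close>; capping \<open>d\<close> at 1 keeps it inside the interval.\<close>
  have "uniformly_continuous_on {- (real N + 1)..real N + 1} \<phi>"
    using cont by (intro compact_uniformly_continuous) (auto intro: continuous_on_subset)
  then obtain d0 where "0 < d0" and d0:
    "\<And>x y. x \<in> {- (real N + 1)..real N + 1} \<Longrightarrow> y \<in> {- (real N + 1)..real N + 1} \<Longrightarrow>
      dist y x < d0 \<Longrightarrow> dist (\<phi> y) (\<phi> x) < e"
    using \<open>0 < e\<close> unfolding uniformly_continuous_on_def by metis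
  define d where "d = min d0 1"
  have "0 < d" using \<open>0 < d0\<close> by (simp add: d_def)
  have close: "\<bar>\<phi> y - \<phi> x\<bar> \<le> e" if "\<bar>x\<bar> < real N" "\<bar>y - x\<bar> < d" for x y
  proof -
    have "x \<in> {- (real N + 1)..real N + 1}" "y \<in> {- (real N + 1)..real N + 1}" "dist y x < d0"
      using that by (auto simp: d_def dist_real_def)
    from d0[OF this] show ?thesis by (simp add: dist_real_def)
  qed
  let ?B = "\<lambda>n. {\<omega>. d \<le> \<bar>Xs n \<omega> - X \<omega>\<bar>}"
  have "(\<lambda>n. capacity E (?B n)) \<longlonglongrightarrow> 0"
    using assms(5) \<open>0 < d\<close> by (simp add: converges_in_capacity_def)
  then have "(\<lambda>n. 2 * M * capacity E (?B n)) \<longlonglongrightarrow> 0"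
    by (rule tendsto_mult_right_zero)
  then have "\<forall>\<^sub>F n in sequentially. 2 * M * capacity E (?B n) < e"
    using \<open>0 < e\<close> by (rule order_tendstoD(2))
  then obtain n0 where n0: "\<And>n. n0 \<le> n \<Longrightarrow> 2 * M * capacity E (?B n) < e"
    by (auto simp: eventually_sequentially)
  \<comment> \<open>The maximum with 1 is taken because \<open>Xs 0\<close> need not lie in
    \<open>H\<close>.\<close>
  have "norm (E (\<lambda>\<omega>. \<phi> (Xs n \<omega>)) - E (\<lambda>\<omega>. \<phi> (X \<omega>))) < r" if n: "max n0 1 \<le> n" for n
  proof -
    have Xn: "Xs n \<in> H" using n assms(4) by simp
    have [measurable]: "X \<in> borel_measurable borel" "Xs n \<in> borel_measurable borel"
      using measurable assms(3) Xn by auto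
    have sets: "?A N \<in> sets borel" "?B n \<in> sets borel"
      by measurable
    have mem: "(\<lambda>\<omega>. \<phi> (Xs n \<omega>)) \<in> H" "(\<lambda>\<omega>. \<phi> (X \<omega>)) \<in> H"
      using bounded_continuous_closed cont bdd Xn assms(3) by blast+
    \<comment> \<open>Outside both sets \<open>close\<close> applies; on either one, a single
      indicator term already gives \<open>2 * M\<close>, the trivial bound.\<close>
    have bound: "\<bar>\<phi> (Xs n \<omega>) - \<phi> (X \<omega>)\<bar>
        \<le> e + (2 * M * indicat_real (?A N) \<omega> + 2 * M * indicat_real (?B n) \<omega>)" for \<omega>
      using M(1) M(2)[of "Xs n \<omega>"] M(2)[of "X \<omega>"] close[of "X \<omega>" "Xs n \<omega>"] \<open>0 < e\<close>
      by (auto simp: indicator_def)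
    \<comment> \<open>As \<open>E\<close> is only sublinear, the difference is bounded from each
      side separately, with the roles of \<open>Xs n\<close> and \<open>X\<close> exchanged.\<close>
    have "E (\<lambda>\<omega>. \<phi> (Xs n \<omega>)) \<le> E (\<lambda>\<omega>. \<phi> (X \<omega>)) + e
        + 2 * M * capacity E (?A N) + 2 * M * capacity E (?B n)"
    proof (rule expectation_le_capacity[OF mem sets])
      show "\<phi> (Xs n \<omega>) \<le> \<phi> (X \<omega>)
          + (e + (2 * M * indicat_real (?A N) \<omega> + 2 * M * indicat_real (?B n) \<omega>))" for \<omega>
        using bound[of \<omega>] by linarith
    qed (use M(1) in simp)
    moreover have "E (\<lambda>\<omega>. \<phi> (X \<omega>)) \<le> E (\<lambda>\<omega>. \<phi> (Xs n \<omega>)) + e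
        + 2 * M * capacity E (?A N) + 2 * M * capacity E (?B n)"
    proof (rule expectation_le_capacity[OF mem(2,1) sets])
      show "\<phi> (X \<omega>) \<le> \<phi> (Xs n \<omega>)
          + (e + (2 * M * indicat_real (?A N) \<omega> + 2 * M * indicat_real (?B n) \<omega>))" for \<omega>
        using bound[of \<omega>] by linarith
    qed (use M(1) in simp)
    ultimately show ?thesis
      using N n0[of n] n by (simp add: e_def abs_less_iff)
  qed
  then show "\<exists>no. \<forall>n\<ge>no.
      norm (E (\<lambda>\<omega>. \<phi> (Xs n \<omega>)) - E (\<lambda>\<omega>. \<phi> (X \<omega>))) < r"
    by blast
qed

end
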